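(* Let $n$ be a positive integer and let $A = e_1 A_1 + e_2 A_2 \in \mathbb{C}_2^{n\times n}$ (with $A_1,A_2$ complex $n\times n$ matrices) be a $\mathbb{C}_2$-idempotent matrix. Then $e_1(I-A)$ is also a $\mathbb{C}_2$-idempotent matrix, where $I$ is the identity matrix of order $n\times n$.
   Context: $\mathbb{C}_1$ is the field of complex numbers (imaginary unit $i_1$). The bicomplex numbers are $\mathbb{C}_2 = \{z_1 + i_2 z_2 : z_1,z_2\in\mathbb{C}_1\}$, a commutative ring with $i_1^2=i_2^2=-1$ and $i_1 i_2 = i_2 i_1$. Put $e_1 = (1+i_1 i_2)/2$ and $e_2 = (1-i_1 i_2)/2$; these satisfy $e_1^2=e_1$, $e_2^2=e_2$, $e_1e_2=0$, $e_1+e_2=1$. $\mathbb{C}_2^{n\times n}$ is the set of $n\times n$ matrices with bicomplex entries, with the usual matrix operations; every such matrix decomposes uniquely as $e_1A_1+e_2A_2$ with $A_1,A_2$ complex $n\times n$ matrices. A matrix $A\in\mathbb{C}_2^{n\times n}$ is called $\mathbb{C}_2$-idempotent if $A^2=A$. *)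

theory Defs
  imports Complex_Main "Jordan_Normal_Form.Matrix"
begin

text \<open>\<open>Bicomplex z1 z2\<close> stands for \<open>z1 + i2 * z2\<close>; see \<open>Bicomplex_eq\<close> below.\<close>

datatype bicomplex = Bicomplex (part1: complex) (part2: complex)

instantiation bicomplex :: comm_ring_1
begin

definition zero_bicomplex :: bicomplex
  where "0 = Bicomplex 0 0"

definition one_bicomplex :: bicomplex
  where "1 = Bicomplex 1 0"

definition plus_bicomplex :: "bicomplex \<Rightarrow> bicomplex \<Rightarrow> bicomplex"
  where "x + y = Bicomplex (part1 x + part1 y) (part2 x + part2 y)"

definition uminus_bicomplex :: "bicomplex \<Rightarrow> bicomplex"
  where "- x = Bicomplex (- part1 x) (- part2 x)"

definition minus_bicomplex :: "bicomplex \<Rightarrow> bicomplex \<Rightarrow> bicomplex"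
  where "x - y = Bicomplex (part1 x - part1 y) (part2 x - part2 y)"

definition times_bicomplex :: "bicomplex \<Rightarrow> bicomplex \<Rightarrow> bicomplex"
  where "x * y = Bicomplex (part1 x * part1 y - part2 x * part2 y)
                           (part1 x * part2 y + part2 x * part1 y)"

instance
  by intro_classes
    (simp_all add: zero_bicomplex_def one_bicomplex_def plus_bicomplex_def
      uminus_bicomplex_def minus_bicomplex_def times_bicomplex_def algebra_simps)

end

definition bicomplex_of_complex :: "complex \<Rightarrow> bicomplex"
  where "bicomplex_of_complex z = Bicomplex z 0"

definition bic_i1 :: bicomplex
  where "bic_i1 = bicomplex_of_complex \<i>"

definition bic_i2 :: bicomplex
  where "bic_i2 = Bicomplex 0 1"

text \<open>The ring has zero divisors, so division by 2 is written as multiplication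
  by the embedded complex number \<open>1/2\<close>.\<close>

definition bic_e1 :: bicomplex
  where "bic_e1 = bicomplex_of_complex (1 / 2) * (1 + bic_i1 * bic_i2)"

definition bic_e2 :: bicomplex
  where "bic_e2 = bicomplex_of_complex (1 / 2) * (1 - bic_i1 * bic_i2)"

lemmas bicomplex_defs =
  zero_bicomplex_def one_bicomplex_def plus_bicomplex_def uminus_bicomplex_def
  minus_bicomplex_def times_bicomplex_def bicomplex_of_complex_def
  bic_i1_def bic_i2_def bic_e1_def bic_e2_def

lemma Bicomplex_eq:
  "Bicomplex z1 z2 = bicomplex_of_complex z1 + bic_i2 * bicomplex_of_complex z2"
  by (simp add: bicomplex_defs)

lemma bic_i1_squared: "bic_i1 * bic_i1 = - 1"
  and bic_i2_squared: "bic_i2 * bic_i2 = - 1"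
  by (simp_all add: bicomplex_defs)

lemma bic_e1_idem: "bic_e1 * bic_e1 = bic_e1"
  and bic_e2_idem: "bic_e2 * bic_e2 = bic_e2"
  and bic_e1_e2: "bic_e1 * bic_e2 = 0"
  and bic_e1_plus_e2: "bic_e1 + bic_e2 = 1"
  by (simp_all add: bicomplex_defs)

definition C2_idempotent :: "nat \<Rightarrow> bicomplex mat \<Rightarrow> bool"
  where "C2_idempotent n A \<longleftrightarrow> A \<in> carrier_mat n n \<and> A ^\<^sub>m 2 = A"

end

theory Submission imports Defs begin

text \<open>Two ring facts combine. The complement of an idempotent is idempotent
  (\<open>idempotent_one_minus_mat\<close>), and scaling an idempotent matrix by an idempotent of a
  commutative ring keeps it idempotent (\<open>idempotent_smult_mat\<close>). The scalar here is
  \<open>bic_e1\<close>, whose square is itself.\<close>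

lemma idempotent_one_minus_mat:
  fixes A :: "'a :: ring_1 mat"
  assumes A: "A \<in> carrier_mat n n" and "A * A = A"
  shows "(1\<^sub>m n - A) * (1\<^sub>m n - A) = 1\<^sub>m n - A"
proof -
  \<comment> \<open>Distributivity on both sides isolates \<open>A - A * A\<close>, which vanishes
    by idempotence.\<close>
  have "(1\<^sub>m n - A) * (1\<^sub>m n - A) = (1\<^sub>m n - A) - (A - A * A)"
    using A by (simp add: mult_minus_distrib_mat[of _ n n _ n] minus_mult_distrib_mat[of _ n n _ _ n]
        minus_carrier_mat)
  also have "\<dots> = 1\<^sub>m n - A"
    using assms by auto
  finally show ?thesis .
qed

text \<open>Over a commutative ring scalars move past matrices, so the square splits into
  \<open>c * c\<close> and \<open>B * B\<close>.\<close>

lemma idempotent_smult_mat: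
  fixes B :: "'a :: comm_ring_1 mat"
  assumes B: "B \<in> carrier_mat n n" and "B * B = B" and "c * c = c"
  shows "(c \<cdot>\<^sub>m B) * (c \<cdot>\<^sub>m B) = c \<cdot>\<^sub>m B"
proof -
  have "(c \<cdot>\<^sub>m B) * (c \<cdot>\<^sub>m B) = (c * c) \<cdot>\<^sub>m (B * B)"
    using B by (auto simp: mult_smult_assoc_mat[of _ n n _ n] mult_smult_distrib[of _ n n _ n]
        mult.assoc intro!: eq_matI)
  then show ?thesis
    using assms by simp
qed

text \<open>Passes from the matrix power to the product form of the two ring facts; writing 2 as a
  double successor lets the recursion of the power unfold.\<close>

lemma C2_idempotent_iff:
  "C2_idempotent n A \<longleftrightarrow> A \<in> carrier_mat n n \<and> A * A = A"
  by (auto simp: C2_idempotent_def numeral_2_eq_2)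

theorem theorem4p9:
  fixes n :: nat
    and A :: "bicomplex mat"
    and A1 A2 :: "complex mat"
  assumes "n > 0"
    and "A1 \<in> carrier_mat n n"
    and "A2 \<in> carrier_mat n n"
    and "A = bic_e1 \<cdot>\<^sub>m map_mat bicomplex_of_complex A1
           + bic_e2 \<cdot>\<^sub>m map_mat bicomplex_of_complex A2"
    and "C2_idempotent n A"
  shows "C2_idempotent n (bic_e1 \<cdot>\<^sub>m (1\<^sub>m n - A))"
  using assms(5)
  by (simp add: C2_idempotent_iff idempotent_smult_mat[of _ n] idempotent_one_minus_mat bic_e1_idem
      minus_carrier_mat)

end
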